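(* If $w\in S_n$ is a boolean permutation, then $\mathrm{canon}(w)$ is an optimal run word for $w$.
   Context: For $w\in S_n$, $s_i$ is the adjacent transposition swapping $i$ and $i+1$; products are compositions of functions. A word $i_1\cdots i_\ell$ is a reduced word of $w$ if $w=s_{i_1}\cdots s_{i_\ell}$ with $\ell$ minimal; $[i_1\cdots i_\ell]$ denotes both this word and the permutation $s_{i_1}\cdots s_{i_\ell}$. A permutation is boolean if some (equivalently, every) reduced word of it consists of distinct letters. Equivalently, it avoids the patterns $321$ and $3412$. A run is an increasing or decreasing sequence of consecutive integers (a single letter is a run). $\mathrm{run}(w)$ is the fewest number of runs whose concatenation is a reduced word of $w$ (minimum over all reduced words of $w$). An optimal run word for $w$ is a reduced word of $w$ that can be written as the concatenation of $\mathrm{run}(w)$ runs. The canonical reduced word $\mathrm{canon}(w)$ of a boolean permutation $w$ is defined recursively. If $w$ is the identity, $\mathrm{canon}(w)$ is empty. Otherwise choose any reduced word $[s]$ of $w$ (the outcome does not depend on the choice) and let $a$ be the smallest letter of $s$. (a) If $a+1$ does not appear in $s$, define $w'$ by $w=[a]\,w'$ and put $\mathrm{canon}(w)=a\cdot\mathrm{canon}(w')$. (b) If $a+1$ appears to the left of $a$ in $s$, let $b\ge a+1$ be the largest integer such that $b(b-1)\cdots a$ is a subsequence of $s$; define $w'$ by $w=[b(b-1)\cdots a]\,w'$ and put $\mathrm{canon}(w)=b(b-1)\cdots a\cdot\mathrm{canon}(w')$. (c) If $a+1$ appears to the right of $a$ in $s$, let $b\ge a+1$ be the largest integer such that $a(a+1)\cdots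 b$ is a subsequence of $s$; define $w'$ by $w=w'\,[a(a+1)\cdots b]$ and put $\mathrm{canon}(w)=\mathrm{canon}(w')\cdot a(a+1)\cdots b$. *)

theory Defs
  imports Main "HOL-Combinatorics.Permutations" "HOL-Library.Sublist"
begin

text \<open>
  Elements of \<open>S_n\<close> are functions \<open>w :: nat \<Rightarrow> nat\<close> with \<open>w permutes {1..n}\<close>; words are lists of
  letters from \<open>{1..n-1}\<close>.
\<close>

definition adj_transp :: "nat \<Rightarrow> nat \<Rightarrow> nat" where
  "adj_transp i = transpose i (i + 1)"

definition word_perm :: "nat list \<Rightarrow> nat \<Rightarrow> nat" where
  "word_perm s = foldr (\<lambda>i f. adj_transp i \<circ> f) s id"

definition word_of :: "nat \<Rightarrow> (nat \<Rightarrow> nat) \<Rightarrow> nat list \<Rightarrow> bool" where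
  "word_of n w s \<longleftrightarrow> set s \<subseteq> {1..<n} \<and> word_perm s = w"

definition reduced_word :: "nat \<Rightarrow> (nat \<Rightarrow> nat) \<Rightarrow> nat list \<Rightarrow> bool" where
  "reduced_word n w s \<longleftrightarrow>
     word_of n w s \<and> (\<forall>t. word_of n w t \<longrightarrow> length s \<le> length t)"

definition boolean_perm :: "nat \<Rightarrow> (nat \<Rightarrow> nat) \<Rightarrow> bool" where
  "boolean_perm n w \<longleftrightarrow> (\<exists>s. reduced_word n w s \<and> distinct s)"

definition ascending :: "nat \<Rightarrow> nat \<Rightarrow> nat list" where
  "ascending a b = [a..<Suc b]"

definition descending :: "nat \<Rightarrow> nat \<Rightarrow> nat list" where
  "descending b a = rev [a..<Suc b]"

definition is_run :: "nat list \<Rightarrow> bool" where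
  "is_run r \<longleftrightarrow> (\<exists>a b. a \<le> b \<and> (r = ascending a b \<or> r = descending b a))"

definition run_number :: "nat \<Rightarrow> (nat \<Rightarrow> nat) \<Rightarrow> nat" where
  "run_number n w =
     (LEAST k. \<exists>rs. length rs = k \<and> (\<forall>r\<in>set rs. is_run r) \<and> reduced_word n w (concat rs))"

definition optimal_run_word :: "nat \<Rightarrow> (nat \<Rightarrow> nat) \<Rightarrow> nat list \<Rightarrow> bool" where
  "optimal_run_word n w s \<longleftrightarrow>
     reduced_word n w s \<and>
     (\<exists>rs. length rs = run_number n w \<and> (\<forall>r\<in>set rs. is_run r) \<and> concat rs = s)"

text \<open>
  \<open>canon_rel n w c\<close> says that \<open>c\<close> is an outcome of the canonical-word recursion on \<open>w\<close> for some
  choices of the reduced words \<open>s\<close> along the way. It is meant for boolean \<open>w\<close>: reduced words then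
  have distinct letters, so the rules \<open>left\<close> and \<open>right\<close> exclude each other and
  \<open>subseq [a + 1, a] s\<close> says that \<open>a + 1\<close> appears to the left of \<open>a\<close> in \<open>s\<close>.
\<close>

inductive canon_rel :: "nat \<Rightarrow> (nat \<Rightarrow> nat) \<Rightarrow> nat list \<Rightarrow> bool" for n :: nat where
  ident: "canon_rel n id []"
| absent: "canon_rel n w (a # c)"
  if "w \<noteq> id" and "reduced_word n w s" and "a = Min (set s)"
    and "a + 1 \<notin> set s"
    and "w = word_perm [a] \<circ> w'" and "canon_rel n w' c"
| left: "canon_rel n w (descending b a @ c)"
  if "w \<noteq> id" and "reduced_word n w s" and "a = Min (set s)"
    and "subseq [a + 1, a] s"
    and "a + 1 \<le> b" and "subseq (descending b a) s"
    and "\<forall>b'\<ge>a + 1. subseq (descending b' a) s \<longrightarrow> b' \<le> b"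
    and "w = word_perm (descending b a) \<circ> w'" and "canon_rel n w' c"
| right: "canon_rel n w (c @ ascending a b)"
  if "w \<noteq> id" and "reduced_word n w s" and "a = Min (set s)"
    and "subseq [a, a + 1] s"
    and "a + 1 \<le> b" and "subseq (ascending a b) s"
    and "\<forall>b'\<ge>a + 1. subseq (ascending a b') s \<longrightarrow> b' \<le> b"
    and "w = w' \<circ> word_perm (ascending a b)" and "canon_rel n w' c"

text \<open>
  The definite description reflects that the outcome exists and does not depend on the choices
  of reduced words.
\<close>

definition canon :: "nat \<Rightarrow> (nat \<Rightarrow> nat) \<Rightarrow> nat list" where
  "canon n w = (THE c. canon_rel n w c)"

end

theory Submission
  imports Defs
begin

text \<open>
  All reduced words of a boolean permutation \<open>w\<close> are words with distinct letters, and two words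
  with distinct letters give the same permutation only if they have the same letters and put each
  pair \<open>i\<close>, \<open>i + 1\<close> of adjacent letters in the same order. Both data can be read off from \<open>w\<close>:
  a letter \<open>i\<close> occurs exactly when \<open>w\<close> carries some \<open>j \<le> i\<close> above \<open>i\<close>, and \<open>i + 1\<close> stands to the
  left of \<open>i\<close> exactly when \<open>w\<close> carries some \<open>j \<le> i\<close> above \<open>i + 1\<close> (\<open>letter_iff_crosses\<close>,
  \<open>descent_pair_iff_crosses\<close>). Hence whether a run is a subsequence of a reduced word depends on \<open>w\<close>
  alone (\<open>run_subseq_unique\<close>).

  Let \<open>a\<close> be the smallest letter. A run containing \<open>a\<close> consists of the letters \<open>a, ..., b\<close> for some
  \<open>b\<close>, in an order dictated by \<open>w\<close>. Choose \<open>b\<close> as large as possible (\<open>greedy_end\<close>). By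
  maximality the one pair of noncommuting letters across the cut, \<open>b\<close> and \<open>b + 1\<close>, is in such an
  order that the block on \<open>a, ..., b\<close> can be moved to the left end of the word if it is descending,
  and to the right end if it is ascending (\<open>greedy_split\<close>). This is precisely a step of the canonical
  recursion, and since \<open>b\<close> depends on \<open>w\<close> alone, so does the outcome of the step
  (\<open>canon_rel_first_block\<close>, \<open>canon_rel_attach_block\<close>).

  The greedy choice is optimal by an exchange argument: given any run decomposition of a reduced
  word of \<open>w\<close>, delete all letters \<open>\<le> b\<close>. Every run remains a run or becomes empty, the run
  containing \<open>a\<close> does become empty because \<open>b\<close> is maximal, and the result is a reduced word of the
  permutation that remains after the canonical step (\<open>remove_first_block\<close>). So a canonical step,
  which costs one run, lowers the number of runs in every competing decomposition by at least one.
\<close>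

section \<open>Crossings and letters\<close>

lemma word_perm_Nil [simp]: "word_perm [] = id"
  by (simp add: word_perm_def)

lemma word_perm_Cons [simp]: "word_perm (x # s) = adj_transp x \<circ> word_perm s"
  by (simp add: word_perm_def)

lemma word_perm_append [simp]: "word_perm (s @ t) = word_perm s \<circ> word_perm t"
  by (induction s) (auto simp: o_assoc)

lemma adj_transp_apply:
  "adj_transp i j = (if j = i then i + 1 else if j = i + 1 then i else j)"
  by (simp add: adj_transp_def transpose_def)

lemma bij_word_perm: "bij (word_perm s)"
proof (induction s)
  case (Cons x s)
  then show ?case
    unfolding word_perm_Cons adj_transp_def by (rule bij_comp) simp
qed (simp add: bij_id[unfolded id_def])

lemma absent_letter_preserves_initial:
  "i \<notin> set s \<Longrightarrow> j \<le> i \<Longrightarrow> word_perm s j \<le> i"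
  by (induction s) (auto simp: adj_transp_apply)

lemma absent_letter_surj_initial:
  assumes "i \<notin> set s"
  obtains j where "j \<le> i" "word_perm s j = i"
proof -
  have "word_perm s ` {..i} = {..i}"
    using absent_letter_preserves_initial[OF assms] bij_word_perm[of s]
    by (intro endo_inj_surj) (auto simp: bij_def intro: inj_on_subset)
  then show ?thesis
    using that by (metis atMost_iff imageE order_refl)
qed

text \<open>
  Only the letter \<open>i\<close> can carry a value from \<open>{0..i}\<close> to above \<open>i\<close> or back. With a single occurrence,
  the value that has reached \<open>i\<close> when this letter acts is carried across and never returns.
\<close>

lemma letter_crosses:
  "distinct s \<Longrightarrow> i \<in> set s \<Longrightarrow> \<exists>j\<le>i. i < word_perm s j"
proof (induction s)
  case (Cons x s)
  show ?case
  proof (cases "x = i")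
    case True
    with Cons.prems obtain j where "j \<le> i" "word_perm s j = i"
      using absent_letter_surj_initial[of i s] by auto
    then show ?thesis
      using True by (intro exI[of _ j]) (simp add: adj_transp_apply)
  next
    case False
    with Cons obtain j where "j \<le> i" "i < word_perm s j" by auto
    then show ?thesis
      using False by (intro exI[of _ j]) (auto simp: adj_transp_apply)
  qed
qed simp

lemma letter_iff_crosses:
  "distinct s \<Longrightarrow> i \<in> set s \<longleftrightarrow> (\<exists>j\<le>i. i < word_perm s j)"
  using letter_crosses absent_letter_preserves_initial by (meson leD)

text \<open>
  To get from \<open>\<le> i\<close> to above \<open>i + 1\<close>, a value must first meet the letter \<open>i\<close> and later the letter
  \<open>i + 1\<close>; letters act from right to left, so \<open>i + 1\<close> is the left one.
\<close>

lemma descent_pair_iff_crosses: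
  "distinct s \<Longrightarrow> subseq [i + 1, i] s \<longleftrightarrow> (\<exists>j\<le>i. i + 1 < word_perm s j)"
proof (induction s)
  case (Cons x s)
  show ?case
  proof (cases "x = i + 1")
    case True
    with Cons.prems have absent: "i + 1 \<notin> set s" and ds: "distinct s" by auto
    have "i + 1 < adj_transp (i + 1) (word_perm s j) \<longleftrightarrow> i < word_perm s j" if "j \<le> i" for j
      using absent_letter_preserves_initial[OF absent, of j] that
      by (auto simp: adj_transp_apply)
    then show ?thesis
      using True letter_iff_crosses[OF ds] by (auto simp: subseq_singleton_left)
  next
    case False
    then have "i + 1 < adj_transp x k \<longleftrightarrow> i + 1 < k" for k
      by (auto simp: adj_transp_apply)
    then show ?thesis
      using Cons False by simp
  qed
qed simp

lemma subseq_set: "subseq r s \<Longrightarrow> set r \<subseteq> set s"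
  by (auto dest: list_emb_set)

lemma distinct_subseq_pair_asym:
  "distinct s \<Longrightarrow> subseq [x, y] s \<Longrightarrow> \<not> subseq [y, x] s"
proof (induction s)
  case (Cons z s)
  have "x \<in> set s" if "subseq [x, y] s \<or> subseq [y, x] s" for x y
    using that subseq_set[of "[x, y]" s] subseq_set[of "[y, x]" s] by auto
  with Cons show ?case
    by (cases "x = y") (auto simp: subseq_singleton_left split: if_splits)
qed simp

lemma subseq_pair_total:
  "x \<in> set s \<Longrightarrow> y \<in> set s \<Longrightarrow> x \<noteq> y \<Longrightarrow> subseq [x, y] s \<or> subseq [y, x] s"
  by (induction s) (auto simp: subseq_singleton_left)

lemma distinct_word_letters_subset:
  assumes "distinct s" "word_perm s = word_perm t"
  shows "set s \<subseteq> set t"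
  using letter_crosses[OF assms(1)] absent_letter_preserves_initial[of _ t] assms(2)
  by (metis leD subsetI)

lemma distinct_word_set_unique:
  assumes "distinct s" "distinct t" "word_perm s = word_perm t"
  shows "set s = set t"
  using distinct_word_letters_subset assms by (metis subset_antisym)

definition adjacent :: "nat \<Rightarrow> nat \<Rightarrow> bool" where
  "adjacent x y \<longleftrightarrow> y = x + 1 \<or> x = y + 1"

lemma adjacent_order_unique:
  assumes "distinct s" "distinct t" "word_perm s = word_perm t" "adjacent x y"
    and "subseq [x, y] s"
  shows "subseq [x, y] t"
proof -
  have desc: "subseq [i + 1, i] s \<longleftrightarrow> subseq [i + 1, i] t" for i
    using descent_pair_iff_crosses assms(1-3) by simp
  have "x \<in> set t" "y \<in> set t"
    using distinct_word_set_unique[OF assms(1-3)] subseq_set[OF assms(5)] by auto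
  moreover have "\<not> subseq [y, x] s"
    by (rule distinct_subseq_pair_asym[OF assms(1,5)])
  moreover have "x \<noteq> y"
    using assms(4) by (auto simp: adjacent_def)
  ultimately have total: "subseq [x, y] t \<or> subseq [y, x] t" and no: "\<not> subseq [y, x] s"
    using subseq_pair_total[of x t y] by blast+
  show ?thesis
  proof (cases "y = x + 1")
    case True
    then have "\<not> subseq [y, x] t"
      using desc[of x] no by (simp only: True not_False_eq_True)
    then show ?thesis
      using total by (simp only: simp_thms)
  next
    case False
    then have x: "x = y + 1"
      using assms(4) by (simp add: adjacent_def)
    show ?thesis
      using desc[of y] assms(5) by (simp only: x)
  qed
qed

text \<open>
  The letters of a distinct word occur in every other word of the same permutation, so no word can
  be shorter, and a word of the same length has no room for repetitions.
\<close>

lemma reduced_iff_distinct: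
  assumes "word_of n w s" "distinct s"
  shows "reduced_word n w t \<longleftrightarrow> word_of n w t \<and> distinct t"
proof -
  have minimal: "length u \<le> card (set v)"
    if u: "word_of n w u" "distinct u" and v: "word_of n w v" for u v
    using distinct_word_letters_subset[of u v] u v distinct_card[OF u(2)] card_mono[of "set v" "set u"]
    by (simp add: word_of_def)
  have "distinct t" if t: "reduced_word n w t"
  proof (rule card_distinct)
    have "length s \<le> card (set t)" "length t \<le> length s"
      using t minimal[OF assms] assms(1) by (simp_all add: reduced_word_def)
    then show "card (set t) = length t"
      using card_length[of t] by simp
  qed
  moreover have "length t \<le> length v" if "word_of n w t" "distinct t" "word_of n w v" for v
    using minimal[OF that] card_length[of v] by simp
  ultimately show ?thesis
    by (auto simp: reduced_word_def)
qed

section \<open>Runs inside distinct words\<close>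

lemma subseq_chain:
  "distinct s \<Longrightarrow> subseq [x, y] s \<Longrightarrow> subseq (y # zs) s \<Longrightarrow> subseq (x # y # zs) s"
proof (induction s)
  case (Cons z s)
  have "y \<in> set s"
    using subseq_set[OF Cons.prems(2)] Cons.prems(1,2) subseq_set[of "[x, y]" s]
    by (auto simp: subseq_singleton_left split: if_splits)
  with Cons show ?case
    by (auto split: if_splits)
qed simp

text \<open>
  In a distinct word each letter has only one position, so the relative order of a list of letters
  is determined by its consecutive pairs. For a run these are pairs of adjacent letters, whose order
  is the same in all distinct words of a permutation.
\<close>

lemma subseq_if_consecutive_pairs:
  "distinct s \<Longrightarrow> set r \<subseteq> set s \<Longrightarrow> successively (\<lambda>x y. subseq [x, y] s) r \<Longrightarrow> subseq r s"
proof (induction r)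
  case (Cons x r)
  then show ?case
    by (cases r) (auto simp: subseq_singleton_left intro: subseq_chain)
qed simp

lemma consecutive_pairs_if_subseq:
  "subseq r s \<Longrightarrow> successively (\<lambda>x y. subseq [x, y] s) r"
proof (induction r)
  case (Cons x r)
  show ?case
  proof (cases r)
    case (Cons y r')
    have "subseq [x, y] (x # y # r')" by simp
    with Cons.prems Cons have "subseq [x, y] s"
      by (metis subseq_order.trans)
    moreover have "subseq r s"
      using Cons.prems by (meson subseq_Cons')
    ultimately show ?thesis
      using Cons Cons.IH by simp
  qed simp
qed simp

lemma set_ascending [simp]: "set (ascending a b) = {a..b}"
  by (auto simp: ascending_def)

lemma set_descending [simp]: "set (descending b a) = {a..b}"
  by (auto simp: descending_def)

lemma descending_Suc: "a \<le> b \<Longrightarrow> descending (Suc b) a = Suc b # descending b a"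
  by (simp add: descending_def)

lemma ascending_Suc: "a \<le> b \<Longrightarrow> ascending a (Suc b) = ascending a b @ [Suc b]"
  by (simp add: ascending_def)

lemma descending_singleton [simp]: "descending a a = [a]"
  by (simp add: descending_def)

lemma ascending_singleton [simp]: "ascending a a = [a]"
  by (simp add: ascending_def)

lemma descending_hd: "a \<le> b \<Longrightarrow> \<exists>l. descending b a = b # l"
  by (simp add: descending_def)

lemma run_adjacent: "is_run r \<Longrightarrow> successively adjacent r"
proof -
  have asc: "successively adjacent [a..<Suc b]" if "a \<le> b" for a b
    using that
    by (induction rule: dec_induct) (auto simp: successively_append_iff adjacent_def)
  moreover have "successively adjacent (rev [a..<Suc b])" if "a \<le> b" for a b
    unfolding successively_rev
    using asc[OF that] by (rule successively_mono) (auto simp: adjacent_def)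
  ultimately show "is_run r \<Longrightarrow> successively adjacent r"
    unfolding is_run_def ascending_def descending_def by blast
qed

lemma run_subseq_unique:
  assumes "distinct s" "distinct t" "word_perm s = word_perm t" "is_run r" "subseq r s"
  shows "subseq r t"
proof (rule subseq_if_consecutive_pairs)
  show "set r \<subseteq> set t"
    using distinct_word_set_unique[OF assms(1-3)] subseq_set[OF assms(5)] by simp
  have "successively (\<lambda>x y. subseq [x, y] s \<and> adjacent x y) r"
    using consecutive_pairs_if_subseq[OF assms(5)] run_adjacent[OF assms(4)]
    by (simp add: successively_conv_nth)
  then show "successively (\<lambda>x y. subseq [x, y] t) r"
    by (rule successively_mono) (auto intro: adjacent_order_unique[OF assms(1-3)])
qed fact

lemma filter_eq_if_subseq:
  assumes "distinct t" "subseq r t" "set r = {x \<in> set t. P x}"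
  shows "filter P t = r"
proof -
  have "filter P r = r"
    using assms(3) by (auto simp: filter_id_conv)
  then have sub: "subseq r (filter P t)"
    using subseq_filter[OF assms(2)] by metis
  have "distinct r"
    using assms(1,2) by (metis distinct_nthsI subseq_conv_nths)
  then have "length r = length (filter P t)"
    using assms(1,3) by (metis distinct_card distinct_filter set_filter)
  then show ?thesis
    using sub subseq_same_length by metis
qed


text \<open>
  If the letters \<open>\<le> b\<close> of a word form a run, this run has the end points \<open>Min (set s)\<close> and \<open>b\<close>.
  This allows both kinds of blocks to be described by the single condition that
  \<open>filter (\<lambda>x. x \<le> b) s\<close> is a run.
\<close>

lemma run_prefix_cases:
  assumes "is_run (filter (\<lambda>x. x \<le> b) s)" "b \<in> set s"
  shows "Min (set s) \<le> b \<and>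
    (filter (\<lambda>x. x \<le> b) s = descending b (Min (set s)) \<or>
     filter (\<lambda>x. x \<le> b) s = ascending (Min (set s)) b)"
proof -
  obtain x y where xy: "x \<le> y"
    "filter (\<lambda>x. x \<le> b) s = ascending x y \<or> filter (\<lambda>x. x \<le> b) s = descending y x"
    using assms(1) by (auto simp: is_run_def)
  then have "set (filter (\<lambda>x. x \<le> b) s) = {x..y}"
    by (elim disjE) (simp_all only: set_ascending set_descending)
  then have mem: "z \<in> set s \<and> z \<le> b \<longleftrightarrow> x \<le> z \<and> z \<le> y" for z
    unfolding set_eq_iff by simp
  have a: "Min (set s) \<in> set s" "Min (set s) \<le> b" "x \<in> set s"
    using assms(2) mem[of x] xy(1) by (auto intro!: Min_in)
  have "y = b"
    using mem[of b] mem[of y] assms(2) xy(1) by auto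
  moreover have "x = Min (set s)"
    using mem[of "Min (set s)"] a by (auto intro!: antisym Min_le)
  ultimately show ?thesis
    using xy a by auto
qed

section \<open>Splitting off the first block\<close>

lemma adj_transp_commute:
  "x \<noteq> y \<Longrightarrow> \<not> adjacent x y \<Longrightarrow> adj_transp x \<circ> adj_transp y = adj_transp y \<circ> adj_transp x"
  by (auto simp: fun_eq_iff adj_transp_apply adjacent_def)

lemma adj_transp_word_perm_commute:
  "\<forall>y\<in>set t. x \<noteq> y \<and> \<not> adjacent x y \<Longrightarrow> adj_transp x \<circ> word_perm t = word_perm t \<circ> adj_transp x"
proof (induction t)
  case (Cons y t)
  have "adj_transp x \<circ> word_perm (y # t) = (adj_transp y \<circ> adj_transp x) \<circ> word_perm t"
    using Cons.prems adj_transp_commute[of x y] by (simp add: o_assoc del: o_apply)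
  also have "\<dots> = adj_transp y \<circ> (adj_transp x \<circ> word_perm t)"
    by (rule comp_assoc)
  also have "adj_transp x \<circ> word_perm t = word_perm t \<circ> adj_transp x"
    using Cons.prems by (intro Cons.IH) simp
  finally show ?case
    by (simp only: word_perm_Cons comp_assoc)
qed simp

text \<open>
  Letters that satisfy \<open>P\<close> can be pulled to the left one at a time, because they commute with all
  the letters that they pass.
\<close>

lemma word_perm_partition:
  assumes "\<And>x y. subseq [x, y] s \<Longrightarrow> \<not> P x \<Longrightarrow> P y \<Longrightarrow> \<not> adjacent x y"
  shows "word_perm s = word_perm (filter P s) \<circ> word_perm (filter (\<lambda>x. \<not> P x) s)"
  using assms
proof (induction s)
  case (Cons x s)
  have IH: "word_perm s = word_perm (filter P s) \<circ> word_perm (filter (\<lambda>x. \<not> P x) s)"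
  proof (rule Cons.IH)
    fix u v
    assume "subseq [u, v] s" "\<not> P u" "P v"
    then show "\<not> adjacent u v"
      using Cons.prems[of u v] by (meson list_emb_Cons)
  qed
  show ?case
  proof (cases "P x")
    case True
    then show ?thesis by (simp add: IH o_assoc)
  next
    case False
    have "\<forall>y\<in>set (filter P s). x \<noteq> y \<and> \<not> adjacent x y"
      using False Cons.prems[of x] by (auto simp: subseq_singleton_left)
    from adj_transp_word_perm_commute[OF this] show ?thesis
      using False by (simp add: IH o_assoc)
  qed
qed simp

definition greedy_end :: "nat list \<Rightarrow> nat \<Rightarrow> bool" where
  "greedy_end s b \<longleftrightarrow> b \<in> set s \<and> is_run (filter (\<lambda>x. x \<le> b) s) \<and>
     (\<forall>b'\<in>set s. is_run (filter (\<lambda>x. x \<le> b') s) \<longrightarrow> b' \<le> b)"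

lemma filter_le_Min:
  assumes "distinct s" "s \<noteq> []"
  shows "filter (\<lambda>x. x \<le> Min (set s)) s = [Min (set s)]"
  using assms by (intro filter_eq_if_subseq) (auto simp: subseq_singleton_left intro: antisym)

lemma is_run_singleton [simp]: "is_run [a]"
  unfolding is_run_def by (intro exI[of _ a]) simp

lemma greedy_end_exists:
  assumes "distinct s" "s \<noteq> []"
  obtains b where "greedy_end s b"
proof -
  let ?B = "{b \<in> set s. is_run (filter (\<lambda>x. x \<le> b) s)}"
  have "Min (set s) \<in> ?B"
    using assms filter_le_Min[OF assms] by simp
  then have "greedy_end s (Max ?B)"
    using Max_in[of ?B] by (auto simp: greedy_end_def)
  then show ?thesis by (rule that)
qed

lemma greedy_end_unique: "greedy_end s b \<Longrightarrow> greedy_end s b' \<Longrightarrow> b = b'"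
  by (auto simp: greedy_end_def intro: antisym)

lemma run_prefix_transfer:
  assumes "distinct s" "distinct t" "word_perm s = word_perm t"
    and "is_run (filter (\<lambda>x. x \<le> b) s)"
  shows "filter (\<lambda>x. x \<le> b) t = filter (\<lambda>x. x \<le> b) s"
  using run_subseq_unique[OF assms] distinct_word_set_unique[OF assms(1-3)] assms(2)
  by (intro filter_eq_if_subseq) auto

lemma greedy_end_transfer:
  assumes "distinct s" "distinct t" "word_perm s = word_perm t" "greedy_end s b"
  shows "greedy_end t b"
  using assms(4) run_prefix_transfer[OF assms(1-3)]
    run_prefix_transfer[OF assms(2,1) assms(3)[symmetric]] distinct_word_set_unique[OF assms(1-3)]
  unfolding greedy_end_def by metis

text \<open>
  The only noncommuting letters on different sides of the cut are \<open>b\<close> and \<open>b + 1\<close>. If \<open>b + 1\<close> blocked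
  the move of the run to its end of the word, then the run could be prolonged by \<open>b + 1\<close>, contrary to
  the maximality of \<open>b\<close>. A block consisting of one letter satisfies both assumptions and can be moved to
  either end.
\<close>

lemma greedy_split:
  assumes s: "distinct s" and b: "greedy_end s b"
  shows "filter (\<lambda>x. x \<le> b) s = descending b (Min (set s)) \<Longrightarrow>
      word_perm s = word_perm (filter (\<lambda>x. x \<le> b) s) \<circ> word_perm (filter (\<lambda>x. b < x) s)"
    and "filter (\<lambda>x. x \<le> b) s = ascending (Min (set s)) b \<Longrightarrow>
      word_perm s = word_perm (filter (\<lambda>x. b < x) s) \<circ> word_perm (filter (\<lambda>x. x \<le> b) s)"
proof -
  let ?a = "Min (set s)" and ?r = "filter (\<lambda>x. x \<le> b) s"
  have bs: "b \<in> set s"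
    using b by (simp add: greedy_end_def)
  then have ab: "?a \<le> b" by simp
  have no_longer_run: False
    if "is_run r" "subseq r s" "set r = insert (Suc b) (set ?r)" for r
  proof -
    have "Suc b \<in> set s"
      using subseq_set[OF that(2)] unfolding that(3) by blast
    moreover from this have "set r = {x \<in> set s. x \<le> Suc b}"
      unfolding that(3) by (auto simp: le_Suc_eq)
    then have "filter (\<lambda>x. x \<le> Suc b) s = r"
      by (rule filter_eq_if_subseq[OF s that(2)])
    ultimately have "Suc b \<le> b"
      using b that(1) unfolding greedy_end_def by metis
    then show False by simp
  qed
  {
    assume r: "?r = descending b ?a"
    have "\<not> adjacent x y" if "subseq [x, y] s" "\<not> x \<le> b" "y \<le> b" for x y
    proof
      assume "adjacent x y"
      with that have xy: "x = Suc b" "y = b" by (auto simp: adjacent_def)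
      obtain l where l: "descending b ?a = b # l"
        using descending_hd[OF ab] by auto
      have "subseq (Suc b # b # l) s"
        using subseq_chain[OF s, of "Suc b" b l] that xy l r subseq_filter_left by metis
      then have "subseq (descending (Suc b) ?a) s"
        by (simp add: descending_Suc[OF ab] l)
      moreover have "is_run (descending (Suc b) ?a)"
        using ab unfolding is_run_def by (intro exI[of _ ?a] exI[of _ "Suc b"]) simp
      ultimately show False
        using no_longer_run r ab by (metis descending_Suc list.simps(15))
    qed
    from word_perm_partition[of s "\<lambda>x. x \<le> b", OF this]
    show "word_perm s = word_perm ?r \<circ> word_perm (filter (\<lambda>x. b < x) s)"
      by (simp add: not_le)
  }
  {
    assume r: "?r = ascending ?a b"
    have "\<not> adjacent x y" if "subseq [x, y] s" "\<not> b < x" "b < y" for x y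
    proof
      assume "adjacent x y"
      with that have xy: "x = b" "y = Suc b" by (auto simp: adjacent_def)
      have sub: "subseq (ascending ?a b) s"
        using r subseq_filter_left by metis
      have "last (ascending ?a b) = b"
        using ab by (simp add: ascending_def)
      then have "successively (\<lambda>x y. subseq [x, y] s) (ascending ?a (Suc b))"
        using consecutive_pairs_if_subseq[OF sub] that(1) xy
        by (simp add: ascending_Suc[OF ab] successively_append_iff)
      moreover have "set (ascending ?a (Suc b)) \<subseteq> set s"
        using subseq_set[OF sub] subseq_set[OF that(1)] xy by (simp add: ascending_Suc[OF ab])
      ultimately have "subseq (ascending ?a (Suc b)) s"
        by (intro subseq_if_consecutive_pairs[OF s])
      moreover have "is_run (ascending ?a (Suc b))"
        using ab unfolding is_run_def by (intro exI[of _ ?a] exI[of _ "Suc b"]) simp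
      moreover have "set (ascending ?a (Suc b)) = insert (Suc b) (set ?r)"
        using r ab by (auto simp: ascending_Suc)
      ultimately show False by (metis no_longer_run)
    qed
    from word_perm_partition[of s "\<lambda>x. b < x", OF this]
    show "word_perm s = word_perm (filter (\<lambda>x. b < x) s) \<circ> word_perm ?r"
      by (simp add: not_less)
  }
qed

section \<open>One step of the canonical recursion\<close>

lemma word_perm_cancel_left: "word_perm r \<circ> f = word_perm r \<circ> g \<Longrightarrow> f = g"
  using bij_word_perm[of r] by (metis bij_is_inj fun.inj_map inj_eq)

lemma word_perm_cancel_right:
  assumes "f \<circ> word_perm r = g \<circ> word_perm r"
  shows "f = g"
proof
  fix x
  obtain y where "x = word_perm r y"
    using bij_word_perm[of r] by (metis bij_is_surj surjD)
  then show "f x = g x"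
    using fun_cong[OF assms, of y] by simp
qed

lemma subseq_ascending_pair: "a < b \<Longrightarrow> subseq [a, a + 1] (ascending a b)"
  by (simp add: ascending_def upt_conv_Cons del: upt_Suc)

lemma subseq_descending_pair: "a < b \<Longrightarrow> subseq [a + 1, a] (descending b a)"
  by (simp add: descending_def upt_conv_Cons subseq_drop_many del: upt_Suc)

lemma word_perm_not_id:
  assumes "distinct s" "s \<noteq> []"
  shows "word_perm s \<noteq> id"
proof -
  from assms(2) have "hd s \<in> set s" by simp
  from letter_crosses[OF assms(1) this] obtain j where "j \<le> hd s" "hd s < word_perm s j" by blast
  then have "word_perm s j \<noteq> id j" by simp
  then show ?thesis by metis
qed

lemma run_prefix_if_subseq:
  assumes "distinct s" "subseq r s" "set r = {Min (set s)..b}"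
  shows "filter (\<lambda>x. x \<le> b) s = r"
proof (rule filter_eq_if_subseq[OF assms(1,2)])
  show "set r = {x \<in> set s. x \<le> b}"
    using subseq_set[OF assms(2)] assms(3) by auto
qed

lemma is_run_descending: "a \<le> b \<Longrightarrow> is_run (descending b a)"
  and is_run_ascending: "a \<le> b \<Longrightarrow> is_run (ascending a b)"
  by (auto simp: is_run_def)

lemma greedy_end_absent:
  assumes "distinct s" "s \<noteq> []" "Min (set s) + 1 \<notin> set s"
  shows "greedy_end s (Min (set s))"
  unfolding greedy_end_def
proof (intro conjI ballI impI)
  show "Min (set s) \<in> set s" using assms(2) by simp
  show "is_run (filter (\<lambda>x. x \<le> Min (set s)) s)" by (simp add: filter_le_Min[OF assms(1,2)])
  fix b assume b: "b \<in> set s" "is_run (filter (\<lambda>x. x \<le> b) s)"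
  have "set (filter (\<lambda>x. x \<le> b) s) = {Min (set s)..b}"
    using run_prefix_cases[OF b(2,1)] by (metis set_ascending set_descending)
  then have "\<not> Min (set s) + 1 \<le> b"
    using assms(3) by (metis atLeastAtMost_iff filter_is_subset le_add1 subsetD)
  then show "b \<le> Min (set s)" by simp
qed

lemma greedy_end_left:
  assumes s: "distinct s" and pair: "subseq [Min (set s) + 1, Min (set s)] s"
    and ab: "Min (set s) + 1 \<le> b" and sub: "subseq (descending b (Min (set s))) s"
    and longest: "\<forall>b'\<ge>Min (set s) + 1. subseq (descending b' (Min (set s))) s \<longrightarrow> b' \<le> b"
  shows "greedy_end s b"
  unfolding greedy_end_def
proof (intro conjI ballI impI)
  show "b \<in> set s" using subseq_set[OF sub] ab by auto
  have "filter (\<lambda>x. x \<le> b) s = descending b (Min (set s))"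
    by (rule run_prefix_if_subseq[OF s sub]) simp
  then show "is_run (filter (\<lambda>x. x \<le> b) s)"
    using ab by (simp add: is_run_descending)
  fix b' assume b': "b' \<in> set s" "is_run (filter (\<lambda>x. x \<le> b') s)"
  show "b' \<le> b"
  proof (cases "Min (set s) + 1 \<le> b'")
    case True
    have "filter (\<lambda>x. x \<le> b') s \<noteq> ascending (Min (set s)) b'"
    proof
      assume "filter (\<lambda>x. x \<le> b') s = ascending (Min (set s)) b'"
      then have "subseq [Min (set s), Min (set s) + 1] (filter (\<lambda>x. x \<le> b') s)"
        using True subseq_ascending_pair[of "Min (set s)" b'] by simp
      then have "subseq [Min (set s), Min (set s) + 1] s"
        by (rule subseq_order.trans) (rule subseq_filter_left)
      then show False
        using distinct_subseq_pair_asym[OF s pair] by simp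
    qed
    then have "subseq (descending b' (Min (set s))) s"
      using run_prefix_cases[OF b'(2,1)] subseq_filter_left by metis
    then show ?thesis using longest True by blast
  qed (use ab in simp)
qed

lemma greedy_end_right:
  assumes s: "distinct s" and pair: "subseq [Min (set s), Min (set s) + 1] s"
    and ab: "Min (set s) + 1 \<le> b" and sub: "subseq (ascending (Min (set s)) b) s"
    and longest: "\<forall>b'\<ge>Min (set s) + 1. subseq (ascending (Min (set s)) b') s \<longrightarrow> b' \<le> b"
  shows "greedy_end s b"
  unfolding greedy_end_def
proof (intro conjI ballI impI)
  show "b \<in> set s" using subseq_set[OF sub] ab by auto
  have "filter (\<lambda>x. x \<le> b) s = ascending (Min (set s)) b"
    by (rule run_prefix_if_subseq[OF s sub]) simp
  then show "is_run (filter (\<lambda>x. x \<le> b) s)"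
    using ab by (simp add: is_run_ascending)
  fix b' assume b': "b' \<in> set s" "is_run (filter (\<lambda>x. x \<le> b') s)"
  show "b' \<le> b"
  proof (cases "Min (set s) + 1 \<le> b'")
    case True
    have "filter (\<lambda>x. x \<le> b') s \<noteq> descending b' (Min (set s))"
    proof
      assume "filter (\<lambda>x. x \<le> b') s = descending b' (Min (set s))"
      then have "subseq [Min (set s) + 1, Min (set s)] (filter (\<lambda>x. x \<le> b') s)"
        using True subseq_descending_pair[of "Min (set s)" b'] by simp
      then have "subseq [Min (set s) + 1, Min (set s)] s"
        by (rule subseq_order.trans) (rule subseq_filter_left)
      then show False
        using distinct_subseq_pair_asym[OF s pair] by simp
    qed
    then have "subseq (ascending (Min (set s)) b') s"
      using run_prefix_cases[OF b'(2,1)] subseq_filter_left by metis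
    then show ?thesis using longest True by blast
  qed (use ab in simp)
qed

lemma ascending_neq_descending: "a < b \<Longrightarrow> ascending a b \<noteq> descending b a"
proof
  assume "a < b" "ascending a b = descending b a"
  then have "hd (ascending a b) = hd (descending b a)" by simp
  with \<open>a < b\<close> show False by (simp add: ascending_def descending_def upt_conv_Cons)
qed

text \<open>
  The inverse of splitting off the first block. For a block of one letter the descending and the
  ascending run coincide; it is put in front, as the canonical word demands.
\<close>

definition attach_block :: "nat list \<Rightarrow> nat \<Rightarrow> nat list \<Rightarrow> nat list" where
  "attach_block s b c =
     (let r = filter (\<lambda>x. x \<le> b) s
      in if r = descending b (Min (set s)) then r @ c else c @ r)"

text \<open>
  The reduced word chosen by the rule may differ from \<open>s\<close>, but it has the same smallest letter and the
  same first block; the remaining permutation is determined by cancelling the block.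
\<close>

lemma canon_rel_first_block:
  assumes canon: "canon_rel n (word_perm s) c"
    and s: "distinct s" "set s \<subseteq> {1..<n}" "s \<noteq> []" and b: "greedy_end s b"
  shows "\<exists>c'. canon_rel n (word_perm (filter (\<lambda>x. b < x) s)) c' \<and> c = attach_block s b c'"
proof -
  let ?w = "word_perm s" and ?a = "Min (set s)" and ?r = "filter (\<lambda>x. x \<le> b) s"
  let ?w' = "word_perm (filter (\<lambda>x. b < x) s)"
  have word: "word_of n ?w s"
    using s(2) by (simp add: word_of_def)
  have reduced: "distinct t \<and> word_perm t = ?w \<and> set t = set s" if "reduced_word n ?w t" for t
    using that reduced_iff_distinct[OF word s(1)] distinct_word_set_unique[OF s(1), of t]
    by (auto simp: word_of_def)
  have end_unique: "b' = b" if "reduced_word n ?w t" "greedy_end t b'" for t b'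
    using greedy_end_transfer[of t s b'] that reduced[OF that(1)] s(1) greedy_end_unique[OF b] by simp
  have prefix_unique: "?r = filter (\<lambda>x. x \<le> b) t" if "reduced_word n ?w t" for t
    using run_prefix_transfer[of s t b] reduced[OF that] s(1) b by (simp add: greedy_end_def)
  show ?thesis
    using canon
  proof cases
    case ident
    then show ?thesis using word_perm_not_id s(1,3) by simp
  next
    case (absent t a w' c')
    note t = reduced[OF absent(3)]
    have a: "a = ?a" using t absent(4) by simp
    have "t \<noteq> []"
      using t s(3) by (metis set_empty)
    then have "greedy_end t a"
      using greedy_end_absent[of t] absent(4,5) t by simp
    then have ba: "b = a" using end_unique[OF absent(3)] by simp
    then have r: "?r = descending b ?a"
      using filter_le_Min[OF s(1,3)] a by simp
    then have "?w = word_perm [a] \<circ> ?w'"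
      using greedy_split(1)[OF s(1) b] ba a by simp
    then have "w' = ?w'"
      using absent(6) word_perm_cancel_left by metis
    then show ?thesis
      using absent(1,7) r ba a by (auto simp: attach_block_def)
  next
    case (left t a b' w' c')
    note t = reduced[OF left(3)]
    have a: "a = ?a" using t left(4) by simp
    have "greedy_end t b'"
      using greedy_end_left[of t b'] left(4-8) t by simp
    then have bb: "b' = b" using end_unique[OF left(3)] by simp
    have "filter (\<lambda>x. x \<le> b') t = descending b' a"
      using run_prefix_if_subseq[of t "descending b' a" b'] left(4,7) t by simp
    then have r: "?r = descending b ?a"
      using prefix_unique[OF left(3)] bb a by simp
    then have "?w = word_perm (descending b' a) \<circ> ?w'"
      using greedy_split(1)[OF s(1) b] bb a by simp
    then have "w' = ?w'"
      using left(9) word_perm_cancel_left by metis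
    then show ?thesis
      using left(1,10) r bb a by (auto simp: attach_block_def)
  next
    case (right t a b' w' c')
    note t = reduced[OF right(3)]
    have a: "a = ?a" using t right(4) by simp
    have "greedy_end t b'"
      using greedy_end_right[of t b'] right(4-8) t by simp
    then have bb: "b' = b" using end_unique[OF right(3)] by simp
    have "filter (\<lambda>x. x \<le> b') t = ascending a b'"
      using run_prefix_if_subseq[of t "ascending a b'" b'] right(4,7) t by simp
    then have r: "?r = ascending ?a b"
      using prefix_unique[OF right(3)] bb a by simp
    then have "?w = ?w' \<circ> word_perm (ascending a b')"
      using greedy_split(2)[OF s(1) b] bb a by simp
    then have "w' = ?w'"
      using right(9) word_perm_cancel_right by metis
    moreover have "?r \<noteq> descending b ?a"
      using ascending_neq_descending[of ?a b] r right(6) bb a by simp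
    ultimately show ?thesis
      using right(1,10) r bb a by (auto simp: attach_block_def)
  qed
qed

lemma canon_rel_attach_block:
  assumes canon: "canon_rel n (word_perm (filter (\<lambda>x. b < x) s)) c'"
    and s: "distinct s" "set s \<subseteq> {1..<n}" "s \<noteq> []" and b: "greedy_end s b"
  shows "canon_rel n (word_perm s) (attach_block s b c')"
proof -
  let ?w = "word_perm s" and ?a = "Min (set s)" and ?r = "filter (\<lambda>x. x \<le> b) s"
  have reduced: "reduced_word n ?w s"
    using reduced_iff_distinct[of n ?w s s] s by (simp add: word_of_def)
  have not_id: "?w \<noteq> id"
    using word_perm_not_id s(1,3) by simp
  have bs: "b \<in> set s" and longest: "\<And>b'. b' \<in> set s \<Longrightarrow> is_run (filter (\<lambda>x. x \<le> b') s) \<Longrightarrow> b' \<le> b"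
    and run: "is_run ?r"
    using b by (auto simp: greedy_end_def)
  have ab: "?a \<le> b"
    using bs by simp
  have longest_run: "b' \<le> b" if "subseq r s" "is_run r" "set r = {?a..b'}" "?a + 1 \<le> b'" for r b'
    using run_prefix_if_subseq[OF s(1) that(1,3)] subseq_set[OF that(1)] that(2-4) by (intro longest) auto
  consider "?a = b" | "?a < b" "?r = descending b ?a" | "?a < b" "?r = ascending ?a b"
    using run_prefix_cases[OF run bs] ab by linarith
  then show ?thesis
  proof cases
    case 1
    have r: "?r = [?a]"
      using filter_le_Min[OF s(1,3)] 1 by simp
    have "?a + 1 \<notin> set s"
    proof
      assume "?a + 1 \<in> set s"
      then have "subseq [?a + 1, ?a] s \<or> subseq [?a, ?a + 1] s"
        using s(3) by (intro subseq_pair_total) auto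
      moreover have "descending (?a + 1) ?a = [?a + 1, ?a]" "ascending ?a (?a + 1) = [?a, ?a + 1]"
        by (simp_all add: descending_Suc ascending_Suc)
      moreover have "{?a, ?a + 1} = {?a..?a + 1}" by auto
      ultimately have "?a + 1 \<le> b"
        using longest_run[of "[?a + 1, ?a]" "?a + 1"] longest_run[of "[?a, ?a + 1]" "?a + 1"]
          is_run_descending[of ?a "?a + 1"] is_run_ascending[of ?a "?a + 1"]
        by (auto simp: insert_commute)
      with 1 show False by simp
    qed
    moreover have "?w = word_perm [?a] \<circ> word_perm (filter (\<lambda>x. b < x) s)"
      using greedy_split(1)[OF s(1) b] r 1 by simp
    ultimately have "canon_rel n ?w (?a # c')"
      using canon_rel.absent[OF not_id reduced refl] canon by blast
    then show ?thesis
      using r 1 by (simp add: attach_block_def)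
  next
    case 2
    have sub: "subseq (descending b ?a) s"
      using 2(2) subseq_filter_left by metis
    have pair: "subseq [?a + 1, ?a] s"
      using subseq_descending_pair[OF 2(1)] sub by (rule subseq_order.trans)
    have "\<forall>b'\<ge>?a + 1. subseq (descending b' ?a) s \<longrightarrow> b' \<le> b"
      using longest_run is_run_descending by simp
    then have "canon_rel n ?w (descending b ?a @ c')"
      using canon_rel.left[OF not_id reduced refl pair _ sub] greedy_split(1)[OF s(1) b 2(2)] 2 canon
      by simp
    then show ?thesis
      using 2 by (simp add: attach_block_def)
  next
    case 3
    have sub: "subseq (ascending ?a b) s"
      using 3(2) subseq_filter_left by metis
    have pair: "subseq [?a, ?a + 1] s"
      using subseq_ascending_pair[OF 3(1)] sub by (rule subseq_order.trans)
    have "\<forall>b'\<ge>?a + 1. subseq (ascending ?a b') s \<longrightarrow> b' \<le> b"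
      using longest_run is_run_ascending by simp
    then have "canon_rel n ?w (c' @ ascending ?a b)"
      using canon_rel.right[OF not_id reduced refl pair _ sub] greedy_split(2)[OF s(1) b 3(2)] 3 canon
      by simp
    then show ?thesis
      using 3 ascending_neq_descending[OF 3(1)] by (simp add: attach_block_def)
  qed
qed

section \<open>Greedy cutting is optimal\<close>

lemma run_filter_greater:
  assumes "is_run r" "filter (\<lambda>x. b < x) r \<noteq> []"
  shows "is_run (filter (\<lambda>x. b < x) r)"
proof -
  have asc: "filter (\<lambda>x. b < x) [u..<Suc v] = [max u (Suc b)..<Suc v]" for u v
    by (induction v) auto
  obtain u v where "r = [u..<Suc v] \<or> r = rev [u..<Suc v]"
    using assms(1) by (auto simp: is_run_def ascending_def descending_def)
  then have f: "filter (\<lambda>x. b < x) r = ascending (max u (Suc b)) v \<or>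
      filter (\<lambda>x. b < x) r = descending v (max u (Suc b))"
    by (auto simp only: asc rev_filter[symmetric] ascending_def descending_def)
  moreover have "max u (Suc b) \<le> v"
    using f assms(2) by (auto simp: ascending_def descending_def split: if_splits)
  ultimately show ?thesis
    using is_run_ascending is_run_descending by metis
qed

text \<open>
  The exchange argument: deleting the letters \<open>\<le> b\<close> from a competing decomposition \<open>ts\<close> empties the
  run that contains the smallest letter, since that run ends at some \<open>v \<le> b\<close>. As \<open>concat ts\<close> has the
  same first block as \<open>s\<close>, cancelling this block shows that the two remainders give the same
  permutation.
\<close>

lemma remove_first_block:
  assumes s: "distinct s" "s \<noteq> []" and b: "greedy_end s b"
    and runs: "\<forall>r\<in>set ts. is_run r" and t: "distinct (concat ts)" "word_perm (concat ts) = word_perm s"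
  obtains us where "\<forall>r\<in>set us. is_run r" "length us < length ts" "distinct (concat us)"
    "word_perm (concat us) = word_perm (filter (\<lambda>x. b < x) s)"
proof
  let ?t = "concat ts" and ?f = "filter (\<lambda>x. b < x)" and ?a = "Min (set s)"
  let ?us = "filter (\<lambda>r. r \<noteq> []) (map ?f ts)"
  have sett: "set ?t = set s"
    using distinct_word_set_unique[OF t(1) s(1) t(2)] .
  have bt: "greedy_end ?t b"
    using greedy_end_transfer[OF s(1) t(1) t(2)[symmetric] b] .
  have concat_us: "concat ?us = ?f ?t"
    by (induction ts) auto
  show "\<forall>r\<in>set ?us. is_run r"
    using runs run_filter_greater by auto
  show "distinct (concat ?us)"
    using t(1) by (simp only: concat_us distinct_filter)
  show "word_perm (concat ?us) = word_perm (?f s)"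
  proof -
    have run: "is_run (filter (\<lambda>x. x \<le> b) s)" and bs: "b \<in> set s"
      using b by (simp_all add: greedy_end_def)
    have prefix: "filter (\<lambda>x. x \<le> b) ?t = filter (\<lambda>x. x \<le> b) s"
      using run_prefix_transfer[OF s(1) t(1) t(2)[symmetric] run] .
    consider "filter (\<lambda>x. x \<le> b) s = descending b ?a" | "filter (\<lambda>x. x \<le> b) s = ascending ?a b"
      using run_prefix_cases[OF run bs] by blast
    then have "word_perm (?f ?t) = word_perm (?f s)"
    proof cases
      case 1
      then show ?thesis
        using greedy_split(1)[OF s(1) b] greedy_split(1)[OF t(1) bt] prefix t(2) word_perm_cancel_left
        unfolding sett by metis
    next
      case 2
      then show ?thesis
        using greedy_split(2)[OF s(1) b] greedy_split(2)[OF t(1) bt] prefix t(2) word_perm_cancel_right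
        unfolding sett by metis
    qed
    then show ?thesis by (simp only: concat_us)
  qed
  show "length ?us < length ts"
  proof -
    have "?a \<in> set ?t"
      using s(2) sett by simp
    then obtain r where r: "r \<in> set ts" "?a \<in> set r" by auto
    obtain us vs where "ts = us @ r # vs"
      using split_list[OF r(1)] by blast
    then have sub: "subseq r ?t"
      by (simp add: subseq_drop_many subseq_rev_drop_many)
    obtain u v where uv: "u \<le> v" "r = ascending u v \<or> r = descending v u"
      using runs r(1) by (auto simp: is_run_def)
    then have setr: "set r = {u..v}" by auto
    have "u \<in> set s" "v \<in> set ?t"
      using subseq_set[OF sub] setr uv(1) sett by auto
    then have "?a = u"
      using r(2) setr by (intro antisym) auto
    then have "filter (\<lambda>x. x \<le> v) ?t = r"
      using run_prefix_if_subseq[OF t(1) sub, of v] setr sett by simp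
    then have "v \<le> b"
      using bt \<open>v \<in> set ?t\<close> runs r(1) unfolding greedy_end_def by metis
    then have "?f r = []"
      using setr by (auto simp: filter_empty_conv)
    then have "length ?us < length (map ?f ts)"
      using r(1) by (intro length_filter_less[of "[]"]) force+
    then show ?thesis by simp
  qed
qed

text \<open>
  Existence, uniqueness and optimality are proved in one induction, since the recursion peels off
  exactly one run per step. Competing decompositions range over all words with distinct letters;
  for a boolean permutation these are its reduced words.
\<close>

lemma canonical_word_exists_unique_optimal:
  assumes "distinct s" "set s \<subseteq> {1..<n}"
  shows "\<exists>rs. (\<forall>c. canon_rel n (word_perm s) c \<longleftrightarrow> c = concat rs) \<and>
    distinct (concat rs) \<and> set (concat rs) = set s \<and> word_perm (concat rs) = word_perm s \<and>
    (\<forall>r\<in>set rs. is_run r) \<and>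
    (\<forall>ts. (\<forall>r\<in>set ts. is_run r) \<longrightarrow> distinct (concat ts) \<longrightarrow> word_perm (concat ts) = word_perm s \<longrightarrow>
      length rs \<le> length ts)"
  using assms
proof (induction "length s" arbitrary: s rule: less_induct)
  case less
  note s = less.prems
  show ?case
  proof (cases "s = []")
    case True
    have "canon_rel n id c \<longleftrightarrow> c = []" for c
      using canon_rel.ident by (auto elim: canon_rel.cases)
    then show ?thesis
      using True by (intro exI[of _ "[]"]) simp
  next
    case False
    obtain b where b: "greedy_end s b"
      using greedy_end_exists[OF s(1) False] by blast
    let ?s' = "filter (\<lambda>x. b < x) s" and ?r = "filter (\<lambda>x. x \<le> b) s"
    have run: "is_run ?r" and bs: "b \<in> set s"
      using b by (simp_all add: greedy_end_def)
    have "length ?s' < length s"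
      using bs by (intro length_filter_less) auto
    moreover have "distinct ?s'" "set ?s' \<subseteq> {1..<n}"
      using s by auto
    ultimately obtain rs where rs: "\<forall>c. canon_rel n (word_perm ?s') c \<longleftrightarrow> c = concat rs"
      "distinct (concat rs)" "set (concat rs) = set ?s'" "word_perm (concat rs) = word_perm ?s'"
      "\<forall>r\<in>set rs. is_run r"
      "\<forall>ts. (\<forall>r\<in>set ts. is_run r) \<longrightarrow> distinct (concat ts) \<longrightarrow>
        word_perm (concat ts) = word_perm ?s' \<longrightarrow> length rs \<le> length ts"
      using less.hyps[of ?s'] by blast
    define rs' where "rs' = (if ?r = descending b (Min (set s)) then ?r # rs else rs @ [?r])"
    have attach: "attach_block s b (concat rs) = concat rs'"
      by (simp add: attach_block_def rs'_def)
    have "canon_rel n (word_perm s) c \<longleftrightarrow> c = concat rs'" for c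
      using canon_rel_first_block[OF _ s False b, of c] canon_rel_attach_block[OF _ s False b, of "concat rs"]
        rs(1) attach by auto
    moreover have "distinct (concat rs')" "set (concat rs') = set s"
    proof -
      have order: "concat rs' = ?r @ concat rs \<or> concat rs' = concat rs @ ?r"
        by (simp add: rs'_def)
      have disjoint: "set ?r \<inter> set (concat rs) = {}" and union: "set ?r \<union> set (concat rs) = set s"
        unfolding rs(3) by auto
      have "distinct ?r"
        using s(1) by simp
      then show "distinct (concat rs')"
        using order rs(2) disjoint by (metis distinct_append inf_commute)
      show "set (concat rs') = set s"
        using order union by (metis set_append sup_commute)
    qed
    moreover have "word_perm (concat rs') = word_perm s"
    proof (cases "?r = descending b (Min (set s))")
      case True
      then have "concat rs' = ?r @ concat rs" by (simp add: rs'_def)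
      then show ?thesis
        using greedy_split(1)[OF s(1) b True] rs(4) by (simp only: word_perm_append)
    next
      case False
      then have "concat rs' = concat rs @ ?r" by (simp add: rs'_def)
      moreover have "?r = ascending (Min (set s)) b"
        using False run_prefix_cases[OF run bs] by blast
      ultimately show ?thesis
        using greedy_split(2)[OF s(1) b] rs(4) by (simp only: word_perm_append)
    qed
    moreover have "\<forall>r\<in>set rs'. is_run r"
    proof -
      have "set rs' = insert ?r (set rs)"
        by (simp add: rs'_def)
      then show ?thesis
        using run rs(5) by (metis insertE)
    qed
    moreover have "length rs' \<le> length ts"
      if ts: "\<forall>r\<in>set ts. is_run r" "distinct (concat ts)" "word_perm (concat ts) = word_perm s" for ts
    proof -
      obtain us where "\<forall>r\<in>set us. is_run r" "length us < length ts" "distinct (concat us)"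
        "word_perm (concat us) = word_perm ?s'"
        using remove_first_block[OF s(1) False b ts] by blast
      then have "length rs < length ts"
        using rs(6) by (meson le_less_trans)
      then show ?thesis by (simp add: rs'_def)
    qed
    ultimately show ?thesis by blast
  qed
qed

theorem corollary4p7:
  fixes n :: nat and w :: "nat \<Rightarrow> nat"
  assumes "w permutes {1..n}"
    and "boolean_perm n w"
  shows "optimal_run_word n w (canon n w)"
proof -
  obtain s where s: "word_of n w s" "distinct s"
    using assms(2) by (auto simp: boolean_perm_def reduced_word_def)
  then have w: "word_perm s = w" "set s \<subseteq> {1..<n}"
    by (auto simp: word_of_def)
  obtain rs where rs: "\<forall>c. canon_rel n w c \<longleftrightarrow> c = concat rs"
    "distinct (concat rs)" "set (concat rs) = set s" "word_perm (concat rs) = w"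
    "\<forall>r\<in>set rs. is_run r"
    "\<forall>ts. (\<forall>r\<in>set ts. is_run r) \<longrightarrow> distinct (concat ts) \<longrightarrow> word_perm (concat ts) = w \<longrightarrow>
      length rs \<le> length ts"
    using canonical_word_exists_unique_optimal[OF s(2) w(2)] unfolding w(1) by blast
  have canon: "canon n w = concat rs"
    unfolding canon_def by (rule the_equality) (simp_all add: rs(1))
  have reduced: "reduced_word n w (concat rs)"
    unfolding reduced_iff_distinct[OF s] using rs(2-4) w(2) by (simp add: word_of_def)
  have "run_number n w = length rs"
    unfolding run_number_def
  proof (rule Least_equality)
    show "\<exists>ts. length ts = length rs \<and> (\<forall>r\<in>set ts. is_run r) \<and> reduced_word n w (concat ts)"
      using rs(5) reduced by blast
  next
    fix k
    assume "\<exists>ts. length ts = k \<and> (\<forall>r\<in>set ts. is_run r) \<and> reduced_word n w (concat ts)"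
    then obtain ts where ts: "length ts = k" "\<forall>r\<in>set ts. is_run r" "reduced_word n w (concat ts)"
      by blast
    from ts(3) have "distinct (concat ts)" "word_perm (concat ts) = w"
      unfolding reduced_iff_distinct[OF s] by (auto simp: word_of_def)
    then show "length rs \<le> k"
      using rs(6) ts(1,2) by blast
  qed
  then show ?thesis
    unfolding optimal_run_word_def canon using reduced rs(5) by auto
qed

end
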